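(* Let $(\mathcal{P}_1,\mathcal{L}_1)$ and $(\mathcal{P}_2,\mathcal{L}_2)$ be two $(n_s,m_k)$-configurations with disjoint point sets, and consider a connected sum of them. Then the minimum number of monochromatic triangles over all line $2$-colorings of the connected sum is less than or equal to the sum of the minimum number of monochromatic triangles over all line $2$-colorings of $(\mathcal{P}_1,\mathcal{L}_1)$ and the minimum number of monochromatic triangles over all line $2$-colorings of $(\mathcal{P}_2,\mathcal{L}_2)$.
   Context: An $(n_s,m_k)$-configuration is a pair $(\mathcal{P},\mathcal{L})$ with $\mathcal{P}$ a set of $n\geq 3$ points and $\mathcal{L}$ a set of $m$ subsets of $\mathcal{P}$ called lines, such that any two distinct points lie together on at most one line, every point is on exactly $s$ lines, and every line contains exactly $k$ points. Three points $p_1,p_2,p_3$ form a triangle if there are lines $l_1,l_2,l_3$ with $p_1,p_2\in l_1$, $p_3\notin l_1$; $p_2,p_3\in l_2$, $p_1\notin l_2$; $p_1,p_3\in l_3$, $p_2\notin l_3$; these lines are uniquely determined by the points, and triangles are counted as unordered triples of points. A line $2$-coloring assigns to each line one of the colors red, blue; a triangle is monochromatic if its lines $l_1,l_2,l_3$ all have the same color. A connected sum of two $(n_s,m_k)$-configurations $(\mathcal{P}_1,\mathcal{L}_1)$, $(\mathcal{P}_2,\mathcal{L}_2)$ (with disjoint point sets) is the $(2n_s,2m_k)$-configuration (that is, with $2n$ points and $2m$ lines, $s$ lines per point and $k$ points per line) obtained as follows: choose a point $p_1\in\mathcal{P}_1$ on a line $l_1\in\mathcal{L}_1$ and a point $p_2\in\mathcal{P}_2$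 on a line $l_2\in\mathcal{L}_2$; take the point set $\mathcal{P}_1\cup\mathcal{P}_2$ and the lines $\mathcal{L}_1\cup\mathcal{L}_2$, except that $l_1$ is replaced by $(l_1\setminus\{p_1\})\cup\{p_2\}$ and $l_2$ by $(l_2\setminus\{p_2\})\cup\{p_1\}$. The result may depend on the choices. *)

theory Defs
  imports Main "HOL-Library.FuncSet"
begin

definition configuration ::
  "nat \<Rightarrow> nat \<Rightarrow> nat \<Rightarrow> nat \<Rightarrow> 'a set \<Rightarrow> 'a set set \<Rightarrow> bool" where
  "configuration n s m k P L \<longleftrightarrow>
     finite P \<and> card P = n \<and> n \<ge> 3 \<and>
     L \<subseteq> Pow P \<and> card L = m \<and>
     (\<forall>p\<in>P. \<forall>q\<in>P. p \<noteq> q \<longrightarrow>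
        (\<forall>l\<in>L. \<forall>l'\<in>L. p \<in> l \<and> q \<in> l \<and> p \<in> l' \<and> q \<in> l' \<longrightarrow> l = l')) \<and>
     (\<forall>p\<in>P. card {l \<in> L. p \<in> l} = s) \<and>
     (\<forall>l\<in>L. card l = k)"

text \<open>The noncollinearity conditions force the three points to be distinct.\<close>

definition triangle_with_lines ::
  "'a set set \<Rightarrow> 'a \<Rightarrow> 'a \<Rightarrow> 'a \<Rightarrow> 'a set \<Rightarrow> 'a set \<Rightarrow> 'a set \<Rightarrow> bool" where
  "triangle_with_lines L p1 p2 p3 l1 l2 l3 \<longleftrightarrow>
     l1 \<in> L \<and> l2 \<in> L \<and> l3 \<in> L \<and>
     p1 \<in> l1 \<and> p2 \<in> l1 \<and> p3 \<notin> l1 \<and>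
     p2 \<in> l2 \<and> p3 \<in> l2 \<and> p1 \<notin> l2 \<and>
     p1 \<in> l3 \<and> p3 \<in> l3 \<and> p2 \<notin> l3"

datatype color = Red | Blue

definition line_colorings :: "'a set set \<Rightarrow> ('a set \<Rightarrow> color) set" where
  "line_colorings L = L \<rightarrow>\<^sub>E UNIV"

text \<open>Triangles are unordered triples of points. In a configuration their three lines are
  uniquely determined, so quantifying existentially over the lines is unambiguous.\<close>

definition monochromatic_triangles ::
  "'a set set \<Rightarrow> ('a set \<Rightarrow> color) \<Rightarrow> 'a set set" where
  "monochromatic_triangles L c =
     {{p1, p2, p3} | p1 p2 p3. \<exists>l1 l2 l3.
        triangle_with_lines L p1 p2 p3 l1 l2 l3 \<and> c l1 = c l2 \<and> c l2 = c l3}"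

definition min_monochromatic_triangles :: "'a set set \<Rightarrow> nat" where
  "min_monochromatic_triangles L =
     (MIN c\<in>line_colorings L. card (monochromatic_triangles L c))"

definition is_connected_sum ::
  "'a set \<Rightarrow> 'a set set \<Rightarrow> 'a set \<Rightarrow> 'a set set \<Rightarrow> 'a set \<Rightarrow> 'a set set \<Rightarrow> bool" where
  "is_connected_sum P1 L1 P2 L2 P L \<longleftrightarrow>
     (\<exists>p1\<in>P1. \<exists>l1\<in>L1. \<exists>p2\<in>P2. \<exists>l2\<in>L2. p1 \<in> l1 \<and> p2 \<in> l2 \<and>
        P = P1 \<union> P2 \<and>
        L = (L1 - {l1}) \<union> (L2 - {l2}) \<union>
            {(l1 - {p1}) \<union> {p2}, (l2 - {p2}) \<union> {p1}})"

end

theory Submission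
  imports Defs
begin

text \<open>The connected sum has no triangle with vertices in both summands: the only lines meeting
  both point sets are the two new ones, the first meets \<open>P2\<close> in \<open>p2\<close> only and the second meets
  \<open>P1\<close> in \<open>p1\<close> only, so the two mixed sides of such a triangle would coincide. Hence if every line
  keeps its colour, each monochromatic triangle of the sum is one of a summand.\<close>

lemma triangle_with_lines_rotate:
  "triangle_with_lines L x y z a b d \<Longrightarrow> triangle_with_lines L y z x b d a"
  by (auto simp: triangle_with_lines_def)

lemma triangle_in_monochromatic_triangles:
  assumes "triangle_with_lines L x y z a b d" "c a = c b" "c b = c d"
  shows "{x, y, z} \<in> monochromatic_triangles L c"
  unfolding monochromatic_triangles_def mem_Collect_eq using assms
  by (intro exI[of _ x] exI[of _ y] exI[of _ z] exI[of _ a] exI[of _ b] exI[of _ d] conjI refl)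

lemma monochromatic_triangles_subset:
  assumes "L \<subseteq> Pow P"
  shows "monochromatic_triangles L c \<subseteq> Pow P"
proof
  fix t assume "t \<in> monochromatic_triangles L c"
  then obtain x y z a b d where "t = {x, y, z}" "triangle_with_lines L x y z a b d"
    unfolding monochromatic_triangles_def by blast
  then show "t \<in> Pow P"
    using assms by (auto simp: triangle_with_lines_def)
qed

lemma finite_line_colorings:
  assumes "finite L"
  shows "finite (line_colorings L)"
proof -
  have "(UNIV :: color set) = {Red, Blue}"
    using color.exhaust by auto
  then have "finite (UNIV :: color set)"
    by (metis finite.emptyI finite.insertI)
  then show ?thesis
    unfolding line_colorings_def using assms by (intro finite_PiE) auto
qed

text \<open>All sides of a triangle lie in \<open>L\<close>, where \<open>restrict c L\<close>
  agrees with \<open>c\<close>, so passing to an extensional colouring changes no monochromatic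
  triangle. A colouring defined on all sets can thus be compared with the minimum directly.\<close>

lemma min_monochromatic_triangles_le:
  assumes "finite L"
  shows "min_monochromatic_triangles L \<le> card (monochromatic_triangles L c)"
proof -
  have "triangle_with_lines L x y z a b d \<and> restrict c L a = restrict c L b \<and> restrict c L b = restrict c L d
      \<longleftrightarrow> triangle_with_lines L x y z a b d \<and> c a = c b \<and> c b = c d" for x y z a b d
    by (auto simp: triangle_with_lines_def)
  then have "monochromatic_triangles L (restrict c L) = monochromatic_triangles L c"
    unfolding monochromatic_triangles_def by simp
  moreover have "restrict c L \<in> line_colorings L"
    by (simp add: line_colorings_def)
  ultimately show ?thesis
    unfolding min_monochromatic_triangles_def using finite_line_colorings[OF assms]
    by (metis Min_le finite_imageI imageI)
qed

lemma min_monochromatic_triangles_attained: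
  assumes "finite L"
  obtains c where "card (monochromatic_triangles L c) = min_monochromatic_triangles L"
proof -
  have "line_colorings L \<noteq> {}"
    by (simp add: line_colorings_def PiE_eq_empty_iff)
  then have "min_monochromatic_triangles L
      \<in> (\<lambda>c. card (monochromatic_triangles L c)) ` line_colorings L"
    unfolding min_monochromatic_triangles_def using finite_line_colorings[OF assms]
    by (intro Min_in) auto
  then show thesis using that by auto
qed

text \<open>The assumptions are symmetric in the two summands, so that facts proved for
  \<open>P1\<close> carry over to \<open>P2\<close> by \<open>swap\<close>. For this reason
  \<open>c\<close> is described by its values on the relevant lines and not by an explicit formula,
  which would have to favour one summand.\<close>

locale colored_connected_sum =
  fixes P1 P2 :: "'a set" and L1 L2 L :: "'a set set" and p1 p2 :: 'a and l1 l2 :: "'a set"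
    and c1 c2 c :: "'a set \<Rightarrow> color"
  assumes lines1: "L1 \<subseteq> Pow P1" and lines2: "L2 \<subseteq> Pow P2"
    and linear1: "\<And>p q l l'. \<lbrakk>p \<noteq> q; l \<in> L1; l' \<in> L1; p \<in> l; q \<in> l; p \<in> l'; q \<in> l'\<rbrakk> \<Longrightarrow> l = l'"
    and linear2: "\<And>p q l l'. \<lbrakk>p \<noteq> q; l \<in> L2; l' \<in> L2; p \<in> l; q \<in> l; p \<in> l'; q \<in> l'\<rbrakk> \<Longrightarrow> l = l'"
    and disjoint: "P1 \<inter> P2 = {}"
    and line1: "l1 \<in> L1" "p1 \<in> l1" and line2: "l2 \<in> L2" "p2 \<in> l2"
    and sum: "L = (L1 - {l1}) \<union> (L2 - {l2}) \<union> {(l1 - {p1}) \<union> {p2}, (l2 - {p2}) \<union> {p1}}"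
    and new_color1: "c ((l1 - {p1}) \<union> {p2}) = c1 l1"
    and new_color2: "c ((l2 - {p2}) \<union> {p1}) = c2 l2"
    \<comment> \<open>Singletons are excluded, since for \<open>k = 1\<close> the new lines are themselves old lines.\<close>
    and old_color1: "\<And>l x y. \<lbrakk>l \<in> L1; l \<noteq> l1; x \<in> l; y \<in> l; x \<noteq> y\<rbrakk> \<Longrightarrow> c l = c1 l"
    and old_color2: "\<And>l x y. \<lbrakk>l \<in> L2; l \<noteq> l2; x \<in> l; y \<in> l; x \<noteq> y\<rbrakk> \<Longrightarrow> c l = c2 l"
begin

lemma swap: "colored_connected_sum P2 P1 L2 L1 L p2 p1 l2 l1 c2 c1 c"
proof
  show "L = (L2 - {l2}) \<union> (L1 - {l1}) \<union> {(l2 - {p2}) \<union> {p1}, (l1 - {p1}) \<union> {p2}}"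
    unfolding sum by (simp add: Un_commute insert_commute)
  show "P2 \<inter> P1 = {}"
    using disjoint by auto
qed (fact lines1 lines2 linear1 linear2 line1 line2 new_color1 new_color2 old_color1 old_color2)+

lemma mixed_line:
  assumes "l \<in> L" "u \<in> l" "v \<in> l" "u \<in> P1" "v \<in> P2"
  shows "l = (l1 - {p1}) \<union> {p2} \<and> v = p2 \<or> l = (l2 - {p2}) \<union> {p1} \<and> u = p1"
proof -
  have "l1 \<inter> P2 = {}" "l2 \<inter> P1 = {}" "l \<notin> L1" "l \<notin> L2"
    using assms lines1 lines2 line1 line2 disjoint by blast+
  then show ?thesis
    using assms unfolding sum by auto
qed

lemma no_mixed_triangle:
  assumes "triangle_with_lines L x y z a b d" "x \<in> P1" "y \<in> P1" "z \<in> P2"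
  shows False
proof -
  have b: "b \<in> L" "y \<in> b" "z \<in> b" "x \<notin> b" and d: "d \<in> L" "x \<in> d" "z \<in> d" "y \<notin> d"
    using assms by (auto simp: triangle_with_lines_def)
  \<comment> \<open>This excludes that \<open>b\<close> and \<open>d\<close> are different new
    lines: one of them would force \<open>z = p2\<close>, while the other contains \<open>z\<close>
    but omits \<open>p2\<close>. If they are the same line, \<open>x\<close> lies on it and does
    not.\<close>
  have "p2 \<notin> (l2 - {p2}) \<union> {p1}"
    using line1 line2 lines1 lines2 disjoint by blast
  then show False
    using mixed_line[OF b(1-3) assms(3,4)] mixed_line[OF d(1-3) assms(2,4)] b d by blast
qed

text \<open>Lines of \<open>L2\<close> miss \<open>P1\<close>, and the new line made from
  \<open>l2\<close> meets \<open>P1\<close> only in \<open>p1\<close>, so neither can contain two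
  distinct points of \<open>P1\<close>.\<close>

lemma line_in_part1:
  assumes "l \<in> L" "x \<in> l" "y \<in> l" "x \<noteq> y" "x \<in> P1" "y \<in> P1"
  obtains "l \<in> L1" "l \<noteq> l1" "c l = c1 l"
  | "l = (l1 - {p1}) \<union> {p2}" "c l = c1 l1" "x \<in> l1" "y \<in> l1" "x \<noteq> p1" "y \<noteq> p1"
proof -
  have "p1 \<in> P1" "p2 \<in> P2"
    using line1 line2 lines1 lines2 by auto
  then consider "l \<in> L1" "l \<noteq> l1" | "l = (l1 - {p1}) \<union> {p2}"
    using assms lines2 line2 disjoint unfolding sum by blast
  then show thesis
  proof cases
    case 1
    then show ?thesis using assms that(1) old_color1 by blast
  next
    case 2
    then have "x \<in> l1" "y \<in> l1" "x \<noteq> p1" "y \<noteq> p1"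
      using assms \<open>p1 \<in> P1\<close> \<open>p2 \<in> P2\<close> disjoint by auto
    with 2 show ?thesis using that(2) new_color1 by simp
  qed
qed

text \<open>A side inside \<open>P1\<close> is pulled back to an old line of the same colour, with
  \<open>l1\<close> standing for the new line made from it. The danger is that \<open>l1\<close>
  regains \<open>p1\<close>, so \<open>z \<notin> l0\<close> would fail for \<open>z = p1\<close>;
  the other side \<open>l'\<close> through \<open>x\<close> rules this out.\<close>

lemma triangle_side_in_part1:
  assumes "l \<in> L" "x \<in> l" "y \<in> l" "z \<notin> l" "x \<noteq> y" "x \<in> P1" "y \<in> P1" "z \<in> P1"
    and "l' \<in> L" "x \<in> l'" "z \<in> l'" "x \<noteq> z"
  obtains l0 where "l0 \<in> L1" "x \<in> l0" "y \<in> l0" "z \<notin> l0" "c1 l0 = c l"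
proof (rule line_in_part1[OF assms(1-3,5-7)])
  assume "l \<in> L1" "c l = c1 l"
  then show thesis using that[of l] assms by auto
next
  assume l: "l = (l1 - {p1}) \<union> {p2}" "c l = c1 l1" "x \<in> l1" "y \<in> l1" "x \<noteq> p1" "y \<noteq> p1"
  have "z \<noteq> p1"
  proof
    \<comment> \<open>The old line through \<open>x\<close> and \<open>p1\<close> was \<open>l1\<close>, and it is no longer there.\<close>
    assume "z = p1"
    moreover from this have "l' \<in> L1" "l' \<noteq> l1"
      using line_in_part1[OF assms(9-12,6,8)] by metis+
    ultimately show False
      using linear1[of x p1 l' l1] l line1 assms by blast
  qed
  then show thesis using that[of l1] l line1 assms by auto
qed

lemma monochromatic_triangle_in_part1:
  assumes "triangle_with_lines L x y z a b d" "c a = c b" "c b = c d"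
    and "x \<in> P1" "y \<in> P1" "z \<in> P1"
  shows "{x, y, z} \<in> monochromatic_triangles L1 c1"
proof -
  have t: "a \<in> L" "b \<in> L" "d \<in> L" "x \<in> a" "y \<in> a" "z \<notin> a" "y \<in> b" "z \<in> b" "x \<notin> b"
      "x \<in> d" "z \<in> d" "y \<notin> d" "x \<noteq> y" "x \<noteq> z" "y \<noteq> z"
    using assms(1) by (auto simp: triangle_with_lines_def)
  \<comment> \<open>The last argument is in each case the other side through the first listed
    vertex.\<close>
  obtain a0 where a: "a0 \<in> L1" "x \<in> a0" "y \<in> a0" "z \<notin> a0" "c1 a0 = c a"
    using triangle_side_in_part1[of a x y z d] t assms(4-6) by blast
  obtain b0 where b: "b0 \<in> L1" "y \<in> b0" "z \<in> b0" "x \<notin> b0" "c1 b0 = c b"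
    using triangle_side_in_part1[of b y z x a] t assms(4-6) by blast
  obtain d0 where d: "d0 \<in> L1" "z \<in> d0" "x \<in> d0" "y \<notin> d0" "c1 d0 = c d"
    using triangle_side_in_part1[of d z x y b] t assms(4-6) by blast
  have "triangle_with_lines L1 x y z a0 b0 d0"
    using a b d by (simp add: triangle_with_lines_def)
  then show ?thesis
    by (rule triangle_in_monochromatic_triangles) (use a b d assms(2,3) in simp_all)
qed

lemma lines_sum: "L \<subseteq> Pow (P1 \<union> P2)"
proof
  fix l assume "l \<in> L"
  moreover have "l1 \<subseteq> P1" "l2 \<subseteq> P2"
    using lines1 lines2 line1 line2 by auto
  ultimately show "l \<in> Pow (P1 \<union> P2)"
    using lines1 lines2 line1 line2 unfolding sum by auto
qed

lemma monochromatic_triangles_sum: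
  "monochromatic_triangles L c \<subseteq> monochromatic_triangles L1 c1 \<union> monochromatic_triangles L2 c2"
proof
  interpret swap: colored_connected_sum P2 P1 L2 L1 L p2 p1 l2 l1 c2 c1 c
    by (rule swap)
  fix t assume "t \<in> monochromatic_triangles L c"
  then obtain x y z a b d where t: "t = {x, y, z}" and
    xyz: "triangle_with_lines L x y z a b d" and c: "c a = c b" "c b = c d"
    unfolding monochromatic_triangles_def by blast
  \<comment> \<open>A mixed triangle has exactly one vertex in one of the parts, and
    \<open>no_mixed_triangle\<close> expects that vertex in third position. The three rotations,
    used for both orders of the summands, cover all cases.\<close>
  note yzx = triangle_with_lines_rotate[OF xyz]
  note zxy = triangle_with_lines_rotate[OF yzx]
  have "{x, y, z} \<subseteq> P1 \<union> P2"
    using xyz lines_sum by (auto simp: triangle_with_lines_def)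
  then have "x \<in> P1 \<and> y \<in> P1 \<and> z \<in> P1 \<or> x \<in> P2 \<and> y \<in> P2 \<and> z \<in> P2"
    using no_mixed_triangle[OF xyz] no_mixed_triangle[OF yzx] no_mixed_triangle[OF zxy]
      swap.no_mixed_triangle[OF xyz] swap.no_mixed_triangle[OF yzx]
      swap.no_mixed_triangle[OF zxy] by blast
  then show "t \<in> monochromatic_triangles L1 c1 \<union> monochromatic_triangles L2 c2"
    unfolding t using monochromatic_triangle_in_part1[OF xyz c]
      swap.monochromatic_triangle_in_part1[OF xyz c] by blast
qed

end

theorem corollary5p3:
  fixes P1 P2 P :: "'a set" and L1 L2 L :: "'a set set" and n s m k :: nat
  assumes "configuration n s m k P1 L1"
    and "configuration n s m k P2 L2"
    and "P1 \<inter> P2 = {}"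
    and "is_connected_sum P1 L1 P2 L2 P L"
  shows "min_monochromatic_triangles L
           \<le> min_monochromatic_triangles L1 + min_monochromatic_triangles L2"
proof -
  have P: "finite P1" "finite P2" and L12: "L1 \<subseteq> Pow P1" "L2 \<subseteq> Pow P2"
    using assms(1,2) by (auto simp: configuration_def)
  then have fin: "finite L1" "finite L2"
    by (auto intro: finite_subset)
  obtain p1 l1 p2 l2 where l1: "l1 \<in> L1" "p1 \<in> l1" and l2: "l2 \<in> L2" "p2 \<in> l2"
    and L: "L = (L1 - {l1}) \<union> (L2 - {l2}) \<union> {(l1 - {p1}) \<union> {p2}, (l2 - {p2}) \<union> {p1}}"
    using assms(4) unfolding is_connected_sum_def by blast
  obtain c1 where c1: "card (monochromatic_triangles L1 c1) = min_monochromatic_triangles L1"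
    using min_monochromatic_triangles_attained[OF fin(1)] .
  obtain c2 where c2: "card (monochromatic_triangles L2 c2) = min_monochromatic_triangles L2"
    using min_monochromatic_triangles_attained[OF fin(2)] .
  \<comment> \<open>Optimal colourings of the summands are glued: each new line inherits the colour
    of the line it replaces. The new lines are tested first, so they take precedence should they
    coincide with old singleton lines.\<close>
  define c where "c = (\<lambda>l. if l = (l1 - {p1}) \<union> {p2} then c1 l1
    else if l = (l2 - {p2}) \<union> {p1} then c2 l2 else if l \<in> L1 then c1 l else c2 l)"
  have p: "p1 \<in> P1" "p2 \<in> P2" "p1 \<notin> P2" "p2 \<notin> P1"
    using l1 l2 L12 assms(3) by blast+
  interpret colored_connected_sum P1 P2 L1 L2 L p1 p2 l1 l2 c1 c2 c
  proof
    show "l = l'" if "p \<noteq> q" "l \<in> L1" "l' \<in> L1" "p \<in> l" "q \<in> l" "p \<in> l'" "q \<in> l'" for p q l l'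
      using that assms(1) L12 unfolding configuration_def by blast
    show "l = l'" if "p \<noteq> q" "l \<in> L2" "l' \<in> L2" "p \<in> l" "q \<in> l" "p \<in> l'" "q \<in> l'" for p q l l'
      using that assms(2) L12 unfolding configuration_def by blast
    show "c ((l1 - {p1}) \<union> {p2}) = c1 l1"
      by (simp add: c_def)
    have "(l2 - {p2}) \<union> {p1} \<noteq> (l1 - {p1}) \<union> {p2}"
      using p by blast
    then show "c ((l2 - {p2}) \<union> {p1}) = c2 l2"
      unfolding c_def by simp
    show "c l = c1 l" if l: "l \<in> L1" "l \<noteq> l1" "x \<in> l" "y \<in> l" "x \<noteq> y" for l x y
    proof -
      \<comment> \<open>The first new line contains \<open>p2\<close>, which is outside
        \<open>P1\<close>; the second has only the point \<open>p1\<close> in \<open>P1\<close>,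
        while \<open>l\<close> has two.\<close>
      have "l \<noteq> (l1 - {p1}) \<union> {p2}" "l \<noteq> (l2 - {p2}) \<union> {p1}"
        using l p L12 l2 assms(3) by blast+
      then show ?thesis using l unfolding c_def by simp
    qed
    show "c l = c2 l" if l: "l \<in> L2" "l \<noteq> l2" "x \<in> l" "y \<in> l" "x \<noteq> y" for l x y
    proof -
      \<comment> \<open>Here \<open>l \<notin> L1\<close> is needed as well, since \<open>c\<close>
        falls back on \<open>c2\<close> only after the test for \<open>L1\<close>; it holds because
        \<open>l\<close> has a point in \<open>P2\<close>.\<close>
      have "l \<noteq> (l1 - {p1}) \<union> {p2}" "l \<noteq> (l2 - {p2}) \<union> {p1}" "l \<notin> L1"
        using l p L12 l1 assms(3) by blast+
      then show ?thesis unfolding c_def by simp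
    qed
  qed (fact L12 assms(3) l1 l2 L)+
  have "finite L"
    unfolding L using fin by simp
  then have "min_monochromatic_triangles L \<le> card (monochromatic_triangles L c)"
    by (rule min_monochromatic_triangles_le)
  also have "\<dots> \<le> card (monochromatic_triangles L1 c1 \<union> monochromatic_triangles L2 c2)"
  proof (rule card_mono[OF _ monochromatic_triangles_sum])
    show "finite (monochromatic_triangles L1 c1 \<union> monochromatic_triangles L2 c2)"
      using monochromatic_triangles_subset[OF L12(1)] monochromatic_triangles_subset[OF L12(2)] P
      by (meson finite_Pow_iff finite_UnI finite_subset)
  qed
  also have "\<dots> \<le> card (monochromatic_triangles L1 c1) + card (monochromatic_triangles L2 c2)"
    by (rule card_Un_le)
  finally show ?thesis
    unfolding c1 c2 .
qed

end
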